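(* Let $S\subseteq\mathsf{ISO}(\mathbb{Z}^n)$ be finite and atomic and let $Z\subseteq\mathbb{Z}^n$ be finite. Let $\rho_{\mathcal{T}}:\mathbb{Z}^n\to\mathbb{Z}^n$ be the map $\rho_{\mathcal{T}}(x)=x-B\lfloor B^\dagger x\rfloor$ associated with a basis matrix $B$ of the translation subgroup $\mathcal{T}_{\langle S\rangle}$, and let $\rho_{\mathsf{WL}}:\rho_{\mathcal{T}}(Z)\to\rho_{\mathcal{T}}(Z)$ be the labeling function produced by the while-loop (described in the context) run on $\rho_{\mathcal{T}}(Z)$. Then the function $$\lambda := \rho_{\mathsf{WL}}\circ\rho_{\mathcal{T}}|_Z$$ is an orbit-labeling map of the action of $\langle S\rangle$ on $\mathbb{Z}^n$, on the subset $Z$; that is, for all $x,x'\in Z$, $\lambda(x)=\lambda(x')$ if and only if $\langle S\rangle\cdot x=\langle S\rangle\cdot x'$.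
   Context: $\mathsf{ISO}(\mathbb{Z}^n)$ is the group (under composition) of all functions $h:\mathbb{Z}^n\to\mathbb{Z}^n$ preserving Euclidean distance; it and its subgroups act on $\mathbb{Z}^n$ by $h\cdot x=h(x)$. A translation is a map $t_v(x)=x+v$ with $v\in\mathbb{Z}^n$. A rotation is a map $r_R(x)=Rx$ with $R\in\mathbb{Z}^{n\times n}$, $R^\top=R^{-1}$; it is a negation if $R$ is diagonal with diagonal entries $\pm1$, and a permutation if $R$ is a permutation matrix. A subset $S\subseteq\mathsf{ISO}(\mathbb{Z}^n)$ is atomic if each of its elements is a translation, a negation or a permutation. $\langle S\rangle$ is the subgroup generated by $S$; $\mathcal{T}_{\langle S\rangle}$ and $\mathcal{R}_{\langle S\rangle}$ are the subgroups of all translations, respectively all rotations, contained in $\langle S\rangle$. The group $\mathcal{T}_{\langle S\rangle}$ is a free $\mathbb{Z}$-module of some rank $m\le n$; $B=[b_1,\ldots,b_m]\in\mathbb{Z}^{n\times m}$ is a basis matrix of it if $\{t_{b_1},\ldots,t_{b_m}\}$ is a $\mathbb{Z}$-basis of $\mathcal{T}_{\langle S\rangle}$. Such a $B$ has full column rank over $\mathbb{R}$; $B^\dagger:=(B^\top B)^{-1}B^\top$, and $\lfloor\cdot\rfloor$ is the coordinate-wise floor. (If $m=0$, $\rho_{\mathcal{T}}$ is the identity.) For $r_R\in\mathcal{R}_{\langle S\rangle}$ and $\omega\in\mathrm{Im}\,\rho_{\mathcal{T}}$, put $r_{R\star}(\omega):=\rho_{\mathcal{T}}(r_R(\omega))$.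 While-loop: initialize $W:=\rho_{\mathcal{T}}(Z)$. While $W\neq\emptyset$: pick an arbitrary $\omega\in W$; compute $C_\omega:=\{r_{R\star}(\omega)\mid r_R\in\mathcal{R}_{\langle S\rangle}\}\cap W$; label every element of $C_\omega$ by $\omega$; replace $W$ by $W\setminus C_\omega$. The function $\rho_{\mathsf{WL}}$ sends each element of $\rho_{\mathcal{T}}(Z)$ to the label it received. *)

theory Defs
  imports
    "Jordan_Normal_Form.Matrix"
    "Jordan_Normal_Form.Gauss_Jordan_Elimination"
    "HOL-Algebra.Group_Action"
    "HOL-Algebra.Generated_Groups"
    "HOL-Library.While_Combinator"
begin

text \<open>
  The lattice of integer vectors of length \<open>n\<close> is \<open>carrier_vec n :: int vec set\<close>.  Functions on it
  are represented extensionally (value \<open>undefined\<close> outside of \<open>carrier_vec n\<close>), so that equality of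
  HOL functions is equality of maps on the lattice.  Explicit dimensions are used because the rank
  \<open>m\<close> of the translation subgroup may be any number from \<open>0\<close> to \<open>n\<close>.
\<close>

definition euclid_dist :: "int vec \<Rightarrow> int vec \<Rightarrow> real" where
  "euclid_dist x y = sqrt (real_of_int ((x - y) \<bullet> (x - y)))"

definition ISO :: "nat \<Rightarrow> (int vec \<Rightarrow> int vec) monoid" where
  "ISO n = \<lparr>
     carrier = {h \<in> carrier_vec n \<rightarrow>\<^sub>E carrier_vec n.
       \<forall>x \<in> carrier_vec n. \<forall>y \<in> carrier_vec n. euclid_dist (h x) (h y) = euclid_dist x y},
     mult = compose (carrier_vec n),
     one = (\<lambda>x \<in> carrier_vec n. x) \<rparr>"

definition translation :: "nat \<Rightarrow> int vec \<Rightarrow> int vec \<Rightarrow> int vec" where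
  "translation n v = (\<lambda>x \<in> carrier_vec n. x + v)"

definition rotation :: "nat \<Rightarrow> int mat \<Rightarrow> int vec \<Rightarrow> int vec" where
  "rotation n R = (\<lambda>x \<in> carrier_vec n. R *\<^sub>v x)"

definition orthogonal_int_mat :: "nat \<Rightarrow> int mat \<Rightarrow> bool" where
  "orthogonal_int_mat n R \<longleftrightarrow> R \<in> carrier_mat n n \<and>
     inverts_mat R (transpose_mat R) \<and> inverts_mat (transpose_mat R) R"

definition permutation_mat :: "nat \<Rightarrow> int mat \<Rightarrow> bool" where
  "permutation_mat n R \<longleftrightarrow>
     (\<exists>p. p permutes {..<n} \<and> R = mat n n (\<lambda>(i, j). if i = p j then 1 else 0))"

definition is_translation :: "nat \<Rightarrow> (int vec \<Rightarrow> int vec) \<Rightarrow> bool" where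
  "is_translation n h \<longleftrightarrow> (\<exists>v \<in> carrier_vec n. h = translation n v)"

definition is_rotation :: "nat \<Rightarrow> (int vec \<Rightarrow> int vec) \<Rightarrow> bool" where
  "is_rotation n h \<longleftrightarrow> (\<exists>R. orthogonal_int_mat n R \<and> h = rotation n R)"

definition is_negation :: "nat \<Rightarrow> (int vec \<Rightarrow> int vec) \<Rightarrow> bool" where
  "is_negation n h \<longleftrightarrow> (\<exists>R. orthogonal_int_mat n R \<and> h = rotation n R \<and>
     diagonal_mat R \<and> (\<forall>i<n. R $$ (i, i) = 1 \<or> R $$ (i, i) = - 1))"

definition is_permutation :: "nat \<Rightarrow> (int vec \<Rightarrow> int vec) \<Rightarrow> bool" where
  "is_permutation n h \<longleftrightarrow> (\<exists>R. orthogonal_int_mat n R \<and> h = rotation n R \<and>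
     permutation_mat n R)"

definition atomic :: "nat \<Rightarrow> (int vec \<Rightarrow> int vec) set \<Rightarrow> bool" where
  "atomic n S \<longleftrightarrow> (\<forall>h \<in> S. is_translation n h \<or> is_negation n h \<or> is_permutation n h)"

abbreviation generated_group ::
    "nat \<Rightarrow> (int vec \<Rightarrow> int vec) set \<Rightarrow> (int vec \<Rightarrow> int vec) monoid" where
  "generated_group n S \<equiv> (ISO n)\<lparr>carrier := generate (ISO n) S\<rparr>"

definition translations_in :: "nat \<Rightarrow> (int vec \<Rightarrow> int vec) set \<Rightarrow> (int vec \<Rightarrow> int vec) set" where
  "translations_in n S = {h \<in> generate (ISO n) S. is_translation n h}"

definition rotations_in :: "nat \<Rightarrow> (int vec \<Rightarrow> int vec) set \<Rightarrow> (int vec \<Rightarrow> int vec) set" where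
  "rotations_in n S = {h \<in> generate (ISO n) S. is_rotation n h}"

text \<open>
  The integer combination of the translations by the columns of \<open>B\<close> with coefficient vector \<open>k\<close>
  is the translation by \<open>B *\<^sub>v k\<close>.  The last two conditions state that the translations by the
  columns generate the translation subgroup and are linearly independent over the integers.
\<close>

definition basis_matrix :: "nat \<Rightarrow> nat \<Rightarrow> (int vec \<Rightarrow> int vec) set \<Rightarrow> int mat \<Rightarrow> bool" where
  "basis_matrix n m S B \<longleftrightarrow> B \<in> carrier_mat n m \<and>
     (\<forall>j<m. translation n (col B j) \<in> translations_in n S) \<and>
     (\<forall>t \<in> translations_in n S. \<exists>k \<in> carrier_vec m. t = translation n (B *\<^sub>v k)) \<and>
     (\<forall>k \<in> carrier_vec m. translation n (B *\<^sub>v k) = \<one>\<^bsub>ISO n\<^esub> \<longrightarrow> k = 0\<^sub>v m)"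

definition pseudo_inverse :: "real mat \<Rightarrow> real mat" where
  "pseudo_inverse A = the (mat_inverse (transpose_mat A * A)) * transpose_mat A"

definition rho_T :: "int mat \<Rightarrow> int vec \<Rightarrow> int vec" where
  "rho_T B x =
     x - B *\<^sub>v map_vec floor (pseudo_inverse (map_mat real_of_int B) *\<^sub>v map_vec real_of_int x)"

definition rot_star :: "int mat \<Rightarrow> (int vec \<Rightarrow> int vec) \<Rightarrow> int vec \<Rightarrow> int vec" where
  "rot_star B r \<omega> = rho_T B (r \<omega>)"

text \<open>
  The loop state consists of the set \<open>W\<close> and the labels given so far.  The arbitrary choice of an
  element of \<open>W\<close> is a parameter \<open>pick\<close>, over which the statement quantifies universally; since \<open>W\<close>
  strictly decreases, every sequence of choices arises from such a function.  Unlabeled elements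
  have the value \<open>undefined\<close>.  If the loop did not terminate, \<open>while\<close> would return an unspecified
  value, so a statement about \<open>rho_WL\<close> includes termination.
\<close>

definition rho_WL :: "nat \<Rightarrow> (int vec \<Rightarrow> int vec) set \<Rightarrow> int mat \<Rightarrow> (int vec set \<Rightarrow> int vec) \<Rightarrow>
    int vec set \<Rightarrow> int vec \<Rightarrow> int vec" where
  "rho_WL n S B pick Z = snd (while
     (\<lambda>(W, label). W \<noteq> {})
     (\<lambda>(W, label).
        let \<omega> = pick W;
            C = {rot_star B r \<omega> | r. r \<in> rotations_in n S} \<inter> W
        in (W - C, \<lambda>x. if x \<in> C then \<omega> else label x))
     (rho_T B ` Z, \<lambda>_. undefined))"

definition orbit_labeling_on ::
    "('g, 'm) monoid_scheme \<Rightarrow> ('g \<Rightarrow> 'x \<Rightarrow> 'x) \<Rightarrow> 'x set \<Rightarrow> ('x \<Rightarrow> 'y) \<Rightarrow> bool" where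
  "orbit_labeling_on G act Z l \<longleftrightarrow>
     (\<forall>x \<in> Z. \<forall>x' \<in> Z. l x = l x' \<longleftrightarrow> orbit G act x = orbit G act x')"

end

theory Submission
  imports Defs "Jordan_Normal_Form.Determinant"
begin

text \<open>
  The rotations normalise the translations, so every element of the generated group is a
  translation of the group after a rotation of the group. Moreover \<open>rho_T B\<close> picks one point out of
  every coset of the translation lattice, because \<open>B\<^sup>\<dagger> B = 1\<close>. Hence two points in the image of
  \<open>rho_T B\<close> lie in the same orbit iff some \<open>rot_star B r\<close> maps one to the other, that is, the
  while-loop removes exactly one orbit in each round.
\<close>

section \<open>Groups of isometries generated by translations and rotations\<close>

lemma ISO_simps:
  "mult (ISO n) = compose (carrier_vec n)"
  "one (ISO n) = (\<lambda>x \<in> carrier_vec n. x)"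
  by (simp_all add: ISO_def)

lemma ISO_closed: "h \<in> carrier (ISO n) \<Longrightarrow> x \<in> carrier_vec n \<Longrightarrow> h x \<in> carrier_vec n"
  by (auto simp: ISO_def)

lemma ISO_extensional: "h \<in> carrier (ISO n) \<Longrightarrow> h \<in> extensional (carrier_vec n)"
  by (auto simp: ISO_def PiE_def)

lemma monoid_ISO: "monoid (ISO n)"
proof
  show "x \<otimes>\<^bsub>ISO n\<^esub> y \<in> carrier (ISO n)"
    if "x \<in> carrier (ISO n)" "y \<in> carrier (ISO n)" for x y
    using that by (auto simp: ISO_def compose_def PiE_iff)
  show "x \<otimes>\<^bsub>ISO n\<^esub> y \<otimes>\<^bsub>ISO n\<^esub> z = x \<otimes>\<^bsub>ISO n\<^esub> (y \<otimes>\<^bsub>ISO n\<^esub> z)"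
    if "x \<in> carrier (ISO n)" "y \<in> carrier (ISO n)" "z \<in> carrier (ISO n)" for x y z
    using that by (auto simp: ISO_simps compose_def ISO_closed)
  show "\<one>\<^bsub>ISO n\<^esub> \<in> carrier (ISO n)"
    by (auto simp: ISO_def)
  show "\<one>\<^bsub>ISO n\<^esub> \<otimes>\<^bsub>ISO n\<^esub> x = x" "x \<otimes>\<^bsub>ISO n\<^esub> \<one>\<^bsub>ISO n\<^esub> = x"
    if "x \<in> carrier (ISO n)" for x
    using that by (auto simp: ISO_simps compose_def ISO_closed ISO_extensional
        intro!: extensionalityI[of _ "carrier_vec n"])
qed

text \<open>\<open>inv\<close> is a definite description in the monoid \<open>ISO n\<close>, so it
  is evaluated by exhibiting an explicit two-sided inverse. This identifies the inverses of the
  generators as concrete translations and rotations.\<close>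

lemma inv_ISO_eqI:
  assumes g: "g \<in> carrier (ISO n)"
    and h: "h \<in> carrier_vec n \<rightarrow>\<^sub>E carrier_vec n"
    and gh: "\<And>x. x \<in> carrier_vec n \<Longrightarrow> g (h x) = x"
    and hg: "\<And>x. x \<in> carrier_vec n \<Longrightarrow> h (g x) = x"
  shows "inv\<^bsub>ISO n\<^esub> g = h"
proof -
  interpret monoid "ISO n" by (rule monoid_ISO)
  have iso: "euclid_dist (g x) (g y) = euclid_dist x y"
    if "x \<in> carrier_vec n" "y \<in> carrier_vec n" for x y
    using g that by (auto simp: ISO_def)
  have hc: "h x \<in> carrier_vec n" if "x \<in> carrier_vec n" for x
    using h that by auto
  \<comment> \<open>Distance preservation passes from \<open>g\<close> to \<open>h\<close>: apply it
    to the points \<open>h x\<close> and \<open>h y\<close>, which \<open>g\<close> sends back to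
    \<open>x\<close> and \<open>y\<close>.\<close>
  have "h \<in> carrier (ISO n)"
    using h iso[OF hc hc] by (auto simp: ISO_def gh)
  moreover have "g \<otimes>\<^bsub>ISO n\<^esub> h = \<one>\<^bsub>ISO n\<^esub>" "h \<otimes>\<^bsub>ISO n\<^esub> g = \<one>\<^bsub>ISO n\<^esub>"
    by (auto simp: ISO_simps compose_def gh hg)
  ultimately show ?thesis
    using inv_unique'[OF g] by simp
qed

lemma translation_closed:
  "v \<in> carrier_vec n \<Longrightarrow> translation n v \<in> carrier_vec n \<rightarrow>\<^sub>E carrier_vec n"
  by (auto simp: translation_def)

lemma rotation_closed:
  "R \<in> carrier_mat n n \<Longrightarrow> rotation n R \<in> carrier_vec n \<rightarrow>\<^sub>E carrier_vec n"
  by (auto simp: rotation_def)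

section \<open>Orthogonal integer matrices and the inverses of generators\<close>

lemma orthogonal_int_matD:
  assumes "orthogonal_int_mat n R"
  shows "R \<in> carrier_mat n n" "R * transpose_mat R = 1\<^sub>m n" "transpose_mat R * R = 1\<^sub>m n"
  using assms by (auto simp: orthogonal_int_mat_def inverts_mat_def)

lemma orthogonal_int_matI:
  assumes "R \<in> carrier_mat n n" "R * transpose_mat R = 1\<^sub>m n" "transpose_mat R * R = 1\<^sub>m n"
  shows "orthogonal_int_mat n R"
  using assms by (auto simp: orthogonal_int_mat_def inverts_mat_def)

lemma orthogonal_int_mat_transpose:
  "orthogonal_int_mat n R \<Longrightarrow> orthogonal_int_mat n (transpose_mat R)"
  by (auto intro!: orthogonal_int_matI dest: orthogonal_int_matD)

lemma orthogonal_int_mat_one: "orthogonal_int_mat n (1\<^sub>m n)"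
  by (auto intro!: orthogonal_int_matI)

lemma orthogonal_int_mat_mult:
  assumes "orthogonal_int_mat n P" "orthogonal_int_mat n Q"
  shows "orthogonal_int_mat n (P * Q)"
proof -
  note P = orthogonal_int_matD[OF assms(1)] and Q = orthogonal_int_matD[OF assms(2)]
  have Pt: "transpose_mat P \<in> carrier_mat n n" and Qt: "transpose_mat Q \<in> carrier_mat n n"
    using P(1) Q(1) by auto
  have "(P * Q) * (transpose_mat Q * transpose_mat P) = P * (Q * transpose_mat Q) * transpose_mat P"
    using assoc_mult_mat[of P n n Q n "transpose_mat Q * transpose_mat P" n]
      assoc_mult_mat[of Q n n "transpose_mat Q" n "transpose_mat P" n]
      assoc_mult_mat[of P n n "Q * transpose_mat Q" n "transpose_mat P" n] P(1) Q(1) Pt Qt by simp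
  moreover have
    "(transpose_mat Q * transpose_mat P) * (P * Q) = transpose_mat Q * (transpose_mat P * P) * Q"
    using assoc_mult_mat[of "transpose_mat Q" n n "transpose_mat P" n "P * Q" n]
      assoc_mult_mat[of "transpose_mat P" n n P n Q n]
      assoc_mult_mat[of "transpose_mat Q" n n "transpose_mat P * P" n Q n] P(1) Q(1) Pt Qt by simp
  ultimately show ?thesis
    using P Q Pt Qt by (intro orthogonal_int_matI) (simp_all add: transpose_mult[OF P(1) Q(1)])
qed

lemma orthogonal_int_mat_cancel:
  assumes "orthogonal_int_mat n R" "x \<in> carrier_vec n"
  shows "R *\<^sub>v (transpose_mat R *\<^sub>v x) = x" "transpose_mat R *\<^sub>v (R *\<^sub>v x) = x"
proof -
  note R = orthogonal_int_matD[OF assms(1)]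
  have Rt: "transpose_mat R \<in> carrier_mat n n"
    using R(1) by simp
  show "R *\<^sub>v (transpose_mat R *\<^sub>v x) = x" "transpose_mat R *\<^sub>v (R *\<^sub>v x) = x"
    using assoc_mult_mat_vec[OF R(1) Rt assms(2)] assoc_mult_mat_vec[OF Rt R(1) assms(2)]
      R(2,3) assms(2) by (metis one_mult_mat_vec)+
qed

lemma inv_translation:
  assumes "v \<in> carrier_vec n" "translation n v \<in> carrier (ISO n)"
  shows "inv\<^bsub>ISO n\<^esub> (translation n v) = translation n (- v)"
proof (rule inv_ISO_eqI[OF assms(2) translation_closed])
  show "translation n v (translation n (- v) x) = x" "translation n (- v) (translation n v x) = x"
    if "x \<in> carrier_vec n" for x
    using assms(1) that by (auto simp: translation_def)
qed (use assms(1) in auto)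

lemma inv_rotation:
  assumes "orthogonal_int_mat n R" "rotation n R \<in> carrier (ISO n)"
  shows "inv\<^bsub>ISO n\<^esub> (rotation n R) = rotation n (transpose_mat R)"
  using assms orthogonal_int_matD(1)[OF assms(1)]
  by (intro inv_ISO_eqI rotation_closed) (auto simp: rotation_def orthogonal_int_mat_cancel)

text \<open>Negations and permutations both come with an orthogonal integer matrix, so the
  inductions below distinguish just two kinds of generators.\<close>

lemma atomic_cases:
  assumes "atomic n S" "h \<in> S"
  obtains v where "v \<in> carrier_vec n" "h = translation n v"
  | R where "orthogonal_int_mat n R" "h = rotation n R"
  using assms
  unfolding atomic_def is_translation_def is_negation_def is_permutation_def by blast

lemma translation_zero: "translation n (0\<^sub>v n) = \<one>\<^bsub>ISO n\<^esub>"
  by (auto simp: translation_def ISO_simps)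

lemma rotation_one: "rotation n (1\<^sub>m n) = \<one>\<^bsub>ISO n\<^esub>"
  by (auto simp: rotation_def ISO_simps)

lemma generate_compose:
  "g \<in> generate (ISO n) S \<Longrightarrow> h \<in> generate (ISO n) S \<Longrightarrow>
    compose (carrier_vec n) g h \<in> generate (ISO n) S"
  using generate.eng[of g "ISO n" S h] by (simp add: ISO_simps)

lemma translation_add_in_generate:
  assumes "v \<in> carrier_vec n" "w \<in> carrier_vec n"
    and "translation n v \<in> generate (ISO n) S" "translation n w \<in> generate (ISO n) S"
  shows "translation n (v + w) \<in> generate (ISO n) S"
proof -
  have "compose (carrier_vec n) (translation n w) (translation n v) = translation n (v + w)"
    using assms(1,2) by (auto simp: compose_def translation_def)
  then show ?thesis
    using generate_compose[OF assms(4,3)] by simp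
qed

section \<open>The structure of the group generated by an atomic set\<close>

context
  fixes n :: nat and S :: "(int vec \<Rightarrow> int vec) set"
  assumes S: "S \<subseteq> carrier (ISO n)" and atomic: "atomic n S"
begin

text \<open>The inverse of a generator is the case with content: it is again an explicit translation
  or rotation, hence a map of the lattice into itself.\<close>

lemma generate_closed:
  assumes "g \<in> generate (ISO n) S" "x \<in> carrier_vec n"
  shows "g x \<in> carrier_vec n"
  using assms
proof (induction arbitrary: x rule: generate.induct)
  case (inv h)
  from atomic \<open>h \<in> S\<close> show ?case
  proof (cases rule: atomic_cases)
    case (1 v)
    then have "inv\<^bsub>ISO n\<^esub> h = translation n (- v)"
      using inv S inv_translation by blast
    then show ?thesis
      using 1 inv by (simp add: translation_def)
  next
    case (2 R)
    then have "inv\<^bsub>ISO n\<^esub> h = rotation n (transpose_mat R)"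
      using inv S inv_rotation by blast
    then show ?thesis
      using inv orthogonal_int_matD(1)[OF 2(1)] by (auto simp: rotation_def)
  qed
qed (use S in \<open>auto simp: ISO_simps compose_def ISO_closed subset_iff\<close>)

lemma generator_inverse:
  assumes h: "h \<in> S" and x: "x \<in> carrier_vec n"
  shows "h ((inv\<^bsub>ISO n\<^esub> h) x) = x" "(inv\<^bsub>ISO n\<^esub> h) (h x) = x"
proof -
  have hc: "h \<in> carrier (ISO n)"
    using h S by auto
  from atomic h have "h ((inv\<^bsub>ISO n\<^esub> h) x) = x \<and> (inv\<^bsub>ISO n\<^esub> h) (h x) = x"
  proof (cases rule: atomic_cases)
    case (1 v)
    then have "inv\<^bsub>ISO n\<^esub> h = translation n (- v)"
      using hc inv_translation by blast
    then show ?thesis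
      using 1 x by (auto simp: translation_def)
  next
    case (2 R)
    then have "inv\<^bsub>ISO n\<^esub> h = rotation n (transpose_mat R)"
      using hc inv_rotation by blast
    then show ?thesis
      using 2 x orthogonal_int_matD(1)[OF 2(1)]
      by (auto simp: rotation_def orthogonal_int_mat_cancel)
  qed
  then show "h ((inv\<^bsub>ISO n\<^esub> h) x) = x" "(inv\<^bsub>ISO n\<^esub> h) (h x) = x" by auto
qed

text \<open>A pointwise substitute for \<open>inv\<close> on the generated group.
  \<open>generate\<close> contains each generator together with its inverse, and a product is undone
  by the product of the inverses in reverse order.\<close>

lemma generate_inverse:
  assumes "g \<in> generate (ISO n) S"
  shows "\<exists>g' \<in> generate (ISO n) S. \<forall>x \<in> carrier_vec n. g (g' x) = x \<and> g' (g x) = x"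
  using assms
proof (induction rule: generate.induct)
  case one
  then show ?case
    by (intro bexI[OF _ generate.one]) (auto simp: ISO_simps)
next
  case (incl h)
  then show ?case
    using generate.inv[of h S "ISO n"] generator_inverse[of h] by auto
next
  case (inv h)
  then show ?case
    using generate.incl[of h S "ISO n"] generator_inverse[of h] by auto
next
  case (eng g h)
  from eng.IH obtain g' h' where
    "g' \<in> generate (ISO n) S" "\<forall>x \<in> carrier_vec n. g (g' x) = x \<and> g' (g x) = x"
    "h' \<in> generate (ISO n) S" "\<forall>x \<in> carrier_vec n. h (h' x) = x \<and> h' (h x) = x"
    by blast
  then show ?case
    using eng.hyps
    by (intro bexI[OF _ generate_compose[of h' n S g']])
      (auto simp: ISO_simps compose_def generate_closed)
qed

text \<open>Reduces equality of orbits to membership. Closure under composition gives one inclusion,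
  the same argument with an inverse of \<open>g\<close> gives the other, and the identity puts
  \<open>y\<close> into its own orbit.\<close>

lemma orbit_eq_iff:
  assumes x: "x \<in> carrier_vec n" and y: "y \<in> carrier_vec n"
  shows "orbit (generated_group n S) (\<lambda>h. h) x = orbit (generated_group n S) (\<lambda>h. h) y \<longleftrightarrow>
    (\<exists>g \<in> generate (ISO n) S. y = g x)"
proof -
  let ?orb = "orbit (generated_group n S) (\<lambda>h. h)"
  have orb: "?orb z = {g z | g. g \<in> generate (ISO n) S}" for z
    by (simp add: orbit_def)
  have sub: "?orb (g z) \<subseteq> ?orb z" if "g \<in> generate (ISO n) S" "z \<in> carrier_vec n" for g z
  proof
    fix w assume "w \<in> ?orb (g z)"
    then obtain h where h: "h \<in> generate (ISO n) S" "w = h (g z)"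
      by (auto simp: orb)
    then have "w = compose (carrier_vec n) h g z"
      using that by (simp add: compose_def)
    then show "w \<in> ?orb z"
      using generate_compose[OF h(1) that(1)] by (auto simp: orb)
  qed
  show ?thesis
  proof
    assume eq: "?orb x = ?orb y"
    have "y = \<one>\<^bsub>ISO n\<^esub> y"
      using y by (simp add: ISO_simps)
    then have "y \<in> ?orb y"
      using generate.one[of "ISO n" S] unfolding orb by blast
    then have "y \<in> ?orb x"
      by (simp add: eq)
    then show "\<exists>g \<in> generate (ISO n) S. y = g x"
      by (auto simp: orb)
  next
    assume "\<exists>g \<in> generate (ISO n) S. y = g x"
    then obtain g where g: "g \<in> generate (ISO n) S" "y = g x" by blast
    then obtain g' where g': "g' \<in> generate (ISO n) S" "x = g' y"
      using generate_inverse[OF g(1)] x by metis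
    show "?orb x = ?orb y"
      using sub[OF g(1) x] sub[OF g'(1) y] unfolding g(2)[symmetric] g'(2)[symmetric] by blast
  qed
qed

lemma translation_uminus_in_generate:
  assumes v: "v \<in> carrier_vec n" and t: "translation n v \<in> generate (ISO n) S"
  shows "translation n (- v) \<in> generate (ISO n) S"
proof -
  obtain g where g: "g \<in> generate (ISO n) S"
    and inv: "\<And>x. x \<in> carrier_vec n \<Longrightarrow> translation n v (g x) = x"
    using generate_inverse[OF t] by blast
  have "g x = x - v" if x: "x \<in> carrier_vec n" for x
  proof -
    have gx: "g x \<in> carrier_vec n"
      by (rule generate_closed[OF g x])
    then have "x = g x + v"
      using inv[OF x] by (simp add: translation_def)
    moreover have "(g x + v) - v = g x"
      using gx v by auto
    ultimately show ?thesis
      by metis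
  qed
  \<comment> \<open>\<open>g\<close> has been computed only at lattice points. Composing with the
    identity yields \<open>undefined\<close> elsewhere, so the result can be equal to a translation
    as a function.\<close>
  then have "compose (carrier_vec n) g (\<one>\<^bsub>ISO n\<^esub>) = translation n (- v)"
    using v by (auto simp: compose_def translation_def ISO_simps minus_add_uminus_vec[of _ n])
  then show ?thesis
    using generate_compose[OF g generate.one] by metis
qed

text \<open>Rotations normalise translations: with \<open>g\<close> inverse to the rotation by
  \<open>R\<close>, rotating \<open>g x + v\<close> gives \<open>x + R *\<^sub>v v\<close>.\<close>

lemma translation_conj_in_generate:
  assumes R: "R \<in> carrier_mat n n" and v: "v \<in> carrier_vec n"
    and r: "rotation n R \<in> generate (ISO n) S" and t: "translation n v \<in> generate (ISO n) S"
  shows "translation n (R *\<^sub>v v) \<in> generate (ISO n) S"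
proof -
  obtain g where g: "g \<in> generate (ISO n) S"
    and inv: "\<And>x. x \<in> carrier_vec n \<Longrightarrow> rotation n R (g x) = x"
    using generate_inverse[OF r] by blast
  have Rg: "R *\<^sub>v g x = x" if "x \<in> carrier_vec n" for x
    using inv[OF that] generate_closed[OF g that] by (simp add: rotation_def)
  have "compose (carrier_vec n) (rotation n R) (compose (carrier_vec n) (translation n v) g) =
    translation n (R *\<^sub>v v)"
    using R v generate_closed[OF g]
    by (auto simp: compose_def rotation_def translation_def mult_add_distrib_mat_vec[OF R] Rg)
  then show ?thesis
    using generate_compose[OF r generate_compose[OF t g]] by metis
qed

text \<open>Maps of this form are closed under composition by the rule of a semidirect product:
  \<open>(v, P)\<close> and \<open>(w, Q)\<close> combine to
  \<open>(P *\<^sub>v w + v, P * Q)\<close>. The point is that both parts lie in the generated group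
  themselves. Inverse generators are translations or rotations again and need no rule of their
  own.\<close>

lemma generate_factorization:
  assumes "g \<in> generate (ISO n) S"
  obtains v R where "v \<in> carrier_vec n" "orthogonal_int_mat n R"
    "translation n v \<in> generate (ISO n) S" "rotation n R \<in> generate (ISO n) S"
    "\<And>x. x \<in> carrier_vec n \<Longrightarrow> g x = R *\<^sub>v x + v"
proof -
  have one: "translation n (0\<^sub>v n) \<in> generate (ISO n) S" "rotation n (1\<^sub>m n) \<in> generate (ISO n) S"
    by (simp_all add: translation_zero rotation_one generate.one)
  let ?P = "\<lambda>g. \<exists>v R. v \<in> carrier_vec n \<and> orthogonal_int_mat n R \<and>
    translation n v \<in> generate (ISO n) S \<and> rotation n R \<in> generate (ISO n) S \<and>
    (\<forall>x \<in> carrier_vec n. g x = R *\<^sub>v x + v)"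
  have trans: "?P (translation n v)"
    if "v \<in> carrier_vec n" "translation n v \<in> generate (ISO n) S" for v
    using that one orthogonal_int_mat_one[of n]
    by (intro exI[of _ v] exI[of _ "1\<^sub>m n"]) (auto simp: translation_def)
  have rot: "?P (rotation n R)"
    if "orthogonal_int_mat n R" "rotation n R \<in> generate (ISO n) S" for R
    using that one orthogonal_int_matD(1)[OF that(1)]
    by (intro exI[of _ "0\<^sub>v n"] exI[of _ R]) (auto simp: rotation_def)
  from assms have "?P g"
  proof (induction rule: generate.induct)
    case one
    then show ?case
      using trans[of "0\<^sub>v n"] generate.one[of "ISO n" S] by (simp add: translation_zero)
  next
    case (incl h)
    then have "h \<in> generate (ISO n) S"
      by (rule generate.incl)
    then show ?case
      using atomic_cases[OF atomic incl] trans rot by metis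
  next
    case (inv h)
    then have h: "inv\<^bsub>ISO n\<^esub> h \<in> generate (ISO n) S"
      by (rule generate.inv)
    from atomic inv show ?case
    proof (cases rule: atomic_cases)
      case (1 v)
      then have "inv\<^bsub>ISO n\<^esub> h = translation n (- v)"
        using inv S inv_translation by blast
      then show ?thesis
        using trans[of "- v"] h 1 by simp
    next
      case (2 R)
      then have "inv\<^bsub>ISO n\<^esub> h = rotation n (transpose_mat R)"
        using inv S inv_rotation by blast
      then show ?thesis
        using rot[of "transpose_mat R"] h orthogonal_int_mat_transpose[OF 2(1)] by simp
    qed
  next
    case (eng g h)
    obtain v P where P: "v \<in> carrier_vec n" "orthogonal_int_mat n P"
      "translation n v \<in> generate (ISO n) S" "rotation n P \<in> generate (ISO n) S"
      and g: "\<forall>x \<in> carrier_vec n. g x = P *\<^sub>v x + v"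
      using eng.IH(1) by blast
    obtain w Q where Q: "w \<in> carrier_vec n" "orthogonal_int_mat n Q"
      "translation n w \<in> generate (ISO n) S" "rotation n Q \<in> generate (ISO n) S"
      and h: "\<forall>x \<in> carrier_vec n. h x = Q *\<^sub>v x + w"
      using eng.IH(2) by blast
    note Pc = orthogonal_int_matD(1)[OF P(2)] and Qc = orthogonal_int_matD(1)[OF Q(2)]
    \<comment> \<open>Moving the rotation \<open>P\<close> past the translation by \<open>w\<close>
      turns \<open>w\<close> into \<open>P *\<^sub>v w\<close>; conjugation keeps that translation
      in the group.\<close>
    have "translation n (P *\<^sub>v w + v) \<in> generate (ISO n) S"
      using translation_conj_in_generate[OF Pc Q(1) P(4) Q(3)] P Q Pc
      by (intro translation_add_in_generate) auto
    moreover have "compose (carrier_vec n) (rotation n P) (rotation n Q) = rotation n (P * Q)"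
      using Pc Qc by (auto simp: compose_def rotation_def)
    then have "rotation n (P * Q) \<in> generate (ISO n) S"
      using generate_compose[OF P(4) Q(4)] by simp
    moreover have "(g \<otimes>\<^bsub>ISO n\<^esub> h) x = (P * Q) *\<^sub>v x + (P *\<^sub>v w + v)" if x: "x \<in> carrier_vec n" for x
    proof -
      have Qx: "Q *\<^sub>v x \<in> carrier_vec n"
        using Qc x by auto
      have "(g \<otimes>\<^bsub>ISO n\<^esub> h) x = P *\<^sub>v (Q *\<^sub>v x + w) + v"
        using x g h Qx Q(1) by (simp add: ISO_simps compose_def)
      also have "\<dots> = (P *\<^sub>v (Q *\<^sub>v x) + P *\<^sub>v w) + v"
        by (simp add: mult_add_distrib_mat_vec[OF Pc Qx Q(1)])
      also have "\<dots> = (P * Q) *\<^sub>v x + (P *\<^sub>v w + v)"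
        using Pc Qc x P(1) Q(1) Qx by (simp add: assoc_add_vec[of _ n])
      finally show ?thesis .
    qed
    ultimately show ?case
      using P Q Pc orthogonal_int_mat_mult[OF P(2) Q(2)]
      by (intro exI[of _ "P *\<^sub>v w + v"] exI[of _ "P * Q"]) auto
  qed
  then show ?thesis
    using that by blast
qed

section \<open>The translation lattice\<close>

lemma translation_smult_in_generate:
  assumes v: "v \<in> carrier_vec n" and t: "translation n v \<in> generate (ISO n) S"
  shows "translation n (a \<cdot>\<^sub>v v) \<in> generate (ISO n) S"
proof (induction a rule: int_induct[where k = 0])
  case base
  have "0 \<cdot>\<^sub>v v = 0\<^sub>v n"
    using v by auto
  then show ?case
    by (simp add: translation_zero generate.one)
next
  case (step1 a)
  have "(a + 1) \<cdot>\<^sub>v v = a \<cdot>\<^sub>v v + v"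
    by (auto simp: algebra_simps)
  then show ?case
    using translation_add_in_generate[OF _ v step1.IH t] v by simp
next
  case (step2 a)
  have "(a - 1) \<cdot>\<^sub>v v = a \<cdot>\<^sub>v v + - v"
    by (auto simp: algebra_simps)
  then show ?case
    using translation_add_in_generate[OF _ _ step2.IH translation_uminus_in_generate[OF v t]] v
    by simp
qed

text \<open>Makes every integer combination of the columns act by a group element, so that moving
  along the lattice never leaves an orbit.\<close>

lemma translation_mult_in_generate:
  assumes B: "B \<in> carrier_mat n m"
    and cols: "\<And>j. j < m \<Longrightarrow> translation n (col B j) \<in> generate (ISO n) S"
    and k: "k \<in> carrier_vec m"
  shows "translation n (B *\<^sub>v k) \<in> generate (ISO n) S"
proof -
  \<comment> \<open>Generalised for induction: \<open>j\<close> bounds the support of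
    \<open>k\<close>, and \<open>j = m\<close> recovers the claim.\<close>
  have "translation n (B *\<^sub>v k) \<in> generate (ISO n) S"
    if "k \<in> carrier_vec m" "\<And>i. j \<le> i \<Longrightarrow> i < m \<Longrightarrow> k $ i = 0" "j \<le> m" for j k
    using that
  proof (induction j arbitrary: k)
    case 0
    then have "k = 0\<^sub>v m"
      by (intro eq_vecI) auto
    then have "B *\<^sub>v k = 0\<^sub>v n"
      using B by auto
    then show ?case
      by (simp add: translation_zero generate.one)
  next
    case (Suc j)
    \<comment> \<open>Deleting coefficient \<open>j\<close> leaves support below \<open>j\<close>;
      the deleted term is a multiple of one column.\<close>
    define k' where "k' = vec m (\<lambda>i. if i = j then 0 else k $ i)"
    have j: "j < m" and k': "k' \<in> carrier_vec m"
      using Suc.prems by (auto simp: k'_def)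
    have col: "col B j \<in> carrier_vec n"
      using B j by auto
    have "translation n (B *\<^sub>v k') \<in> generate (ISO n) S"
      using Suc.prems by (intro Suc.IH) (auto simp: k'_def)
    moreover have "B *\<^sub>v k = B *\<^sub>v k' + (k $ j) \<cdot>\<^sub>v col B j"
    proof (rule eq_vecI)
      fix i assume "i < dim_vec (B *\<^sub>v k' + (k $ j) \<cdot>\<^sub>v col B j)"
      then have i: "i < n"
        using B by auto
      have "(B *\<^sub>v k) $ i = (\<Sum>l\<in>{0..<m}. B $$ (i, l) * k $ l)"
        using B i Suc.prems(1) by (auto simp: scalar_prod_def)
      also have "\<dots> = (\<Sum>l\<in>{0..<m}. B $$ (i, l) * k' $ l + (if l = j then B $$ (i, l) * k $ l else 0))"
        by (intro sum.cong) (auto simp: k'_def)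
      also have "\<dots> = (\<Sum>l\<in>{0..<m}. B $$ (i, l) * k' $ l) + B $$ (i, j) * k $ j"
        using j by (simp add: sum.distrib)
      also have "\<dots> = (B *\<^sub>v k' + (k $ j) \<cdot>\<^sub>v col B j) $ i"
        using B i j k' by (auto simp: scalar_prod_def)
      finally show "(B *\<^sub>v k) $ i = (B *\<^sub>v k' + (k $ j) \<cdot>\<^sub>v col B j) $ i" .
    qed (use B in auto)
    ultimately show ?case
      using translation_add_in_generate[OF _ _ _ translation_smult_in_generate[OF col cols[OF j]]]
        B k' col by auto
  qed
  from this[of k m] k show ?thesis by auto
qed

end

section \<open>The map \<open>rho_T\<close> as a choice of coset representatives\<close>

lemma scalar_prod_self_eq_0_int:
  fixes v :: "int vec"
  assumes "v \<in> carrier_vec n" "v \<bullet> v = 0"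
  shows "v = 0\<^sub>v n"
proof (rule eq_vecI)
  have "(\<Sum>i\<in>{0..<n}. v $ i * v $ i) = 0"
    using assms by (simp add: scalar_prod_def)
  then have "\<forall>i\<in>{0..<n}. v $ i * v $ i = 0"
    by (subst (asm) sum_nonneg_eq_0_iff) auto
  then show "v $ i = 0\<^sub>v n $ i" if "i < dim_vec (0\<^sub>v n)" for i
    using that by auto
qed (use assms in auto)

text \<open>Linear independence over the integers suffices, since the Gram matrix is an integer matrix.\<close>

lemma pseudo_inverse_left_inverse:
  fixes B :: "int mat"
  assumes B: "B \<in> carrier_mat n m"
    and indep: "\<And>k. k \<in> carrier_vec m \<Longrightarrow> B *\<^sub>v k = 0\<^sub>v n \<Longrightarrow> k = 0\<^sub>v m"
  defines "A \<equiv> map_mat real_of_int B"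
  shows "pseudo_inverse A \<in> carrier_mat m n" "pseudo_inverse A * A = 1\<^sub>m m"
proof -
  let ?M = "transpose_mat B * B"
  have Bt: "transpose_mat B \<in> carrier_mat m n" and M: "?M \<in> carrier_mat m m"
    using B by auto
  have A: "A \<in> carrier_mat n m" and At: "transpose_mat A \<in> carrier_mat m n"
    using B by (auto simp: A_def)
  \<comment> \<open>A singular integer Gram matrix has a nonzero integer kernel vector
    \<open>v\<close>. Then \<open>B *\<^sub>v v\<close> has squared length 0, so it vanishes,
    against independence.\<close>
  have "det ?M \<noteq> 0"
  proof
    assume "det ?M = 0"
    then obtain v where v: "v \<in> carrier_vec m" "v \<noteq> 0\<^sub>v m" "?M *\<^sub>v v = 0\<^sub>v m"
      using det_0_iff_vec_prod_zero[OF M] by blast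
    have Bv: "B *\<^sub>v v \<in> carrier_vec n"
      using B v by auto
    have "(B *\<^sub>v v) \<bullet> (B *\<^sub>v v) = (transpose_mat B *\<^sub>v (B *\<^sub>v v)) \<bullet> v"
      using transpose_vec_mult_scalar[OF B v(1) Bv] by simp
    also have "\<dots> = 0"
      using v(1,3) unfolding assoc_mult_mat_vec[OF Bt B v(1)] by simp
    finally show False
      using scalar_prod_self_eq_0_int[OF Bv] indep v by auto
  qed
  moreover have "transpose_mat A * A = map_mat real_of_int ?M"
    unfolding A_def of_int_hom.mat_hom_mult[OF Bt B] by (simp add: map_mat_transpose)
  ultimately have "det (transpose_mat A * A) \<noteq> 0"
    by simp
  moreover have AtA: "transpose_mat A * A \<in> carrier_mat m m"
    using A At by auto
  \<comment> \<open>The nonzero determinant rules out \<open>None\<close>, so \<open>the\<close> in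
    \<open>pseudo_inverse\<close> yields a genuine inverse.\<close>
  ultimately obtain C where C: "mat_inverse (transpose_mat A * A) = Some C"
    using mat_inverse(1)[OF AtA, of "()"] det_non_zero_imp_unit[OF AtA, of "()"]
    by (cases "mat_inverse (transpose_mat A * A)") auto
  then have C': "C * (transpose_mat A * A) = 1\<^sub>m m" "C \<in> carrier_mat m m"
    using mat_inverse(2)[OF AtA] by auto
  have pinv: "pseudo_inverse A = C * transpose_mat A"
    by (simp add: pseudo_inverse_def C)
  show "pseudo_inverse A \<in> carrier_mat m n"
    using C' At by (auto simp: pinv)
  show "pseudo_inverse A * A = 1\<^sub>m m"
    using C' assoc_mult_mat[OF C'(2) At A] by (simp add: pinv)
qed

text \<open>The pseudo-inverse sends \<open>B *\<^sub>v k\<close> to the integer vector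
  \<open>k\<close>, and an integer shift passes through the floor unchanged. So the amount
  subtracted grows by exactly the amount added.\<close>

lemma rho_T_add_lattice:
  fixes B :: "int mat"
  assumes B: "B \<in> carrier_mat n m"
    and indep: "\<And>k. k \<in> carrier_vec m \<Longrightarrow> B *\<^sub>v k = 0\<^sub>v n \<Longrightarrow> k = 0\<^sub>v m"
    and x: "x \<in> carrier_vec n" and k: "k \<in> carrier_vec m"
  shows "rho_T B (x + B *\<^sub>v k) = rho_T B x"
proof -
  let ?A = "map_mat real_of_int B"
  let ?P = "pseudo_inverse ?A"
  note P = pseudo_inverse_left_inverse[OF B indep]
  have A: "?A \<in> carrier_mat n m"
    using B by auto
  have Bk: "B *\<^sub>v k \<in> carrier_vec n"
    using B k by auto
  let ?q = "?P *\<^sub>v map_vec real_of_int x"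
  let ?f = "map_vec floor ?q"
  have q: "?q \<in> carrier_vec m" and f: "?f \<in> carrier_vec m"
    using P(1) x by auto
  have "?P *\<^sub>v map_vec real_of_int (B *\<^sub>v k) = (?P * ?A) *\<^sub>v map_vec real_of_int k"
    using P(1) A k by (simp add: of_int_hom.mult_mat_vec_hom[OF B k])
  also have "\<dots> = map_vec real_of_int k"
    using P(2) k by simp
  finally have PBk: "?P *\<^sub>v map_vec real_of_int (B *\<^sub>v k) = map_vec real_of_int k" .
  have "map_vec real_of_int (x + B *\<^sub>v k) = map_vec real_of_int x + map_vec real_of_int (B *\<^sub>v k)"
    using x B by (intro eq_vecI) auto
  then have "?P *\<^sub>v map_vec real_of_int (x + B *\<^sub>v k) = ?q + map_vec real_of_int k"
    using x Bk mult_add_distrib_mat_vec[OF P(1)] PBk by simp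
  then have fl: "map_vec floor (?P *\<^sub>v map_vec real_of_int (x + B *\<^sub>v k)) = ?f + k"
    using q k by (auto simp: vec_eq_iff)
  have Bf: "B *\<^sub>v ?f \<in> carrier_vec n"
    using B f by auto
  show ?thesis
    unfolding rho_T_def fl mult_add_distrib_mat_vec[OF B f k]
    using x Bk Bf by (auto simp: vec_eq_iff)
qed

text \<open>The coefficients are the negated floors. Together with the invariance above this says
  that \<open>rho_T B\<close> selects one point of each lattice coset.\<close>

lemma rho_T_eq_add_lattice:
  assumes B: "B \<in> carrier_mat n m"
    and indep: "\<And>k. k \<in> carrier_vec m \<Longrightarrow> B *\<^sub>v k = 0\<^sub>v n \<Longrightarrow> k = 0\<^sub>v m"
    and x: "x \<in> carrier_vec n"
  shows "\<exists>k \<in> carrier_vec m. rho_T B x = x + B *\<^sub>v k"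
proof -
  let ?f = "map_vec floor (pseudo_inverse (map_mat real_of_int B) *\<^sub>v map_vec real_of_int x)"
  have f: "?f \<in> carrier_vec m"
    using pseudo_inverse_left_inverse(1)[OF B indep] x by auto
  have "B *\<^sub>v (- v) = - (B *\<^sub>v v)" if "v \<in> carrier_vec m" for v
    using B that by (intro eq_vecI) auto
  from this[OF f] have "rho_T B x = x + B *\<^sub>v (- ?f)"
    using B x by (auto simp: rho_T_def minus_add_uminus_vec[of _ n])
  then show ?thesis
    using f by (intro bexI[of _ "- ?f"]) auto
qed

section \<open>The labeling loop\<close>

text \<open>Separates the loop from the geometry: \<open>f\<close> will be the orbit map and
  \<open>cls w\<close> the set of \<open>rot_star\<close> images of \<open>w\<close>. Each round
  removes all of one fibre of \<open>f\<close> in \<open>W\<^sub>0\<close>, so a fibre is never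
  split between two labels.\<close>

lemma while_class_labels:
  fixes W\<^sub>0 :: "'a set" and l\<^sub>0 :: "'a \<Rightarrow> 'a" and cls :: "'a \<Rightarrow> 'a set" and f :: "'a \<Rightarrow> 'b"
  assumes fin: "finite W\<^sub>0"
    and pick: "\<And>W. W \<noteq> {} \<Longrightarrow> pick W \<in> W"
    and cls: "\<And>w y. w \<in> W\<^sub>0 \<Longrightarrow> y \<in> W\<^sub>0 \<Longrightarrow> y \<in> cls w \<longleftrightarrow> f y = f w"
  defines "l \<equiv> snd (while (\<lambda>(W, label). W \<noteq> {})
     (\<lambda>(W, label). let \<omega> = pick W; C = cls \<omega> \<inter> W
        in (W - C, \<lambda>x. if x \<in> C then \<omega> else label x))
     (W\<^sub>0, l\<^sub>0))"
  assumes xy: "x \<in> W\<^sub>0" "y \<in> W\<^sub>0"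
  shows "l x = l y \<longleftrightarrow> f x = f y"
proof -
  \<comment> \<open>A label stays in the fibre of what it labels, which separates different fibres.
    The last conjunct says that a fibre, once touched, has left \<open>W\<close> completely and
    carries a constant label.\<close>
  let ?P = "\<lambda>(W, l). W \<subseteq> W\<^sub>0 \<and> (\<forall>x \<in> W\<^sub>0 - W. f (l x) = f x) \<and>
    (\<forall>x \<in> W\<^sub>0 - W. \<forall>y \<in> W\<^sub>0. f x = f y \<longrightarrow> y \<notin> W \<and> l x = l y)"
  let ?Q = "\<lambda>(W, l). \<forall>x \<in> W\<^sub>0. \<forall>y \<in> W\<^sub>0. l x = l y \<longleftrightarrow> f x = f y"
  let ?b = "\<lambda>(W, label). W \<noteq> {}"
  let ?c = "\<lambda>(W, label). let \<omega> = pick W; C = cls \<omega> \<inter> W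
        in (W - C, \<lambda>x. if x \<in> C then \<omega> else label x)"
  have "?Q (while ?b ?c (W\<^sub>0, l\<^sub>0))"
  proof (rule while_rule2[where P = ?P and r = "inv_image finite_psubset fst"])
    show "?P (W\<^sub>0, l\<^sub>0)" by simp
    show "wf (inv_image finite_psubset (fst :: 'a set \<times> ('a \<Rightarrow> 'a) \<Rightarrow> 'a set))" by simp
    show "?Q s" if "?P s" "\<not> ?b s" for s
    proof -
      obtain W l where s: "s = (W, l)" by (cases s)
      have "f (l z) = f z" if "z \<in> W\<^sub>0" for z
        using \<open>?P s\<close> \<open>\<not> ?b s\<close> that unfolding s by blast
      moreover have "l z = l z'" if "z \<in> W\<^sub>0" "z' \<in> W\<^sub>0" "f z = f z'" for z z'
        using \<open>?P s\<close> \<open>\<not> ?b s\<close> that unfolding s by blast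
      ultimately show ?thesis
        unfolding s prod.case by metis
    qed
    show "?P (?c s) \<and> (?c s, s) \<in> inv_image finite_psubset fst" if "?P s" "?b s" for s
    proof -
      obtain W l where s: "s = (W, l)" by (cases s)
      define w where "w = pick W"
      define C where "C = {y \<in> W. f y = f w}"
      have W: "W \<subseteq> W\<^sub>0" "W \<noteq> {}"
        using \<open>?P s\<close> \<open>?b s\<close> by (auto simp: s)
      have w: "w \<in> W"
        using pick W by (simp add: w_def)
      have "cls w \<inter> W = C"
        using W w cls by (auto simp: C_def)
      then have c: "?c s = (W - C, \<lambda>x. if x \<in> C then w else l x)"
        by (simp only: s prod.case Let_def flip: w_def)
      \<comment> \<open>The picked element belongs to its own fibre, so every round shrinks the
        finite set \<open>W\<close>; this is the termination argument.\<close>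
      have "w \<in> C"
        using w by (simp add: C_def)
      then have dec: "W - C \<subset> W"
        using w by auto
      have fin_W: "finite W"
        using W(1) fin by (rule finite_subset)
      have "?P (W - C, \<lambda>x. if x \<in> C then w else l x)"
        unfolding prod.case
      proof (intro conjI ballI impI)
        have label: "f (l z) = f z" if "z \<in> W\<^sub>0 - W" for z
          using \<open>?P s\<close> that unfolding s by blast
        have sat: "z' \<notin> W \<and> l z = l z'" if "z \<in> W\<^sub>0 - W" "z' \<in> W\<^sub>0" "f z = f z'" for z z'
          using \<open>?P s\<close> that unfolding s by blast
        show "W - C \<subseteq> W\<^sub>0"
          using W(1) by auto
        fix z assume z: "z \<in> W\<^sub>0 - (W - C)"
        show "f (if z \<in> C then w else l z) = f z"
          using z label[of z] by (auto simp: C_def)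
        fix z' assume z': "z' \<in> W\<^sub>0" "f z = f z'"
        have "z \<in> C \<longleftrightarrow> z' \<in> C" "z' \<notin> W - C"
          using sat[of z z'] sat[of z' z] z z' W(1) unfolding C_def by auto
        then show "z' \<notin> W - C" "(if z \<in> C then w else l z) = (if z' \<in> C then w else l z')"
          using sat[of z z'] z z' by auto
      qed
      then show ?thesis
        unfolding c by (rule conjI) (use dec fin_W s in simp)
    qed
  qed
  then show ?thesis
    using xy unfolding l_def case_prod_unfold by blast
qed

theorem theorem10p4:
  fixes n m :: nat
    and S :: "(int vec \<Rightarrow> int vec) set"
    and Z :: "int vec set"
    and B :: "int mat"
    and pick :: "int vec set \<Rightarrow> int vec"
  assumes "S \<subseteq> carrier (ISO n)" and "finite S" and "atomic n S"
    and "Z \<subseteq> carrier_vec n" and "finite Z"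
    and "basis_matrix n m S B"
    and "\<And>W. W \<noteq> {} \<Longrightarrow> pick W \<in> W"
  shows "orbit_labeling_on (generated_group n S) (\<lambda>h. h) Z
           (restrict (rho_WL n S B pick Z \<circ> rho_T B) Z)"
proof -
  let ?G = "generate (ISO n) S"
  let ?orb = "orbit (generated_group n S) (\<lambda>h. h)"
  note SA = assms(1,3)
  \<comment> \<open>Independence of the translations becomes independence of the columns because the
    identity is the translation by zero.\<close>
  have B: "B \<in> carrier_mat n m"
    and cols: "\<And>j. j < m \<Longrightarrow> translation n (col B j) \<in> ?G"
    and span: "\<And>t. t \<in> translations_in n S \<Longrightarrow> \<exists>k \<in> carrier_vec m. t = translation n (B *\<^sub>v k)"
    and indep: "\<And>k. k \<in> carrier_vec m \<Longrightarrow> B *\<^sub>v k = 0\<^sub>v n \<Longrightarrow> k = 0\<^sub>v m"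
    using assms(6) by (auto simp: basis_matrix_def translations_in_def translation_zero)
  have rho_closed: "rho_T B x \<in> carrier_vec n" if "x \<in> carrier_vec n" for x
    using rho_T_eq_add_lattice[OF B indep that] B that by auto
  have orb_rho: "?orb (rho_T B x) = ?orb x" if x: "x \<in> carrier_vec n" for x
  proof -
    obtain k where k: "k \<in> carrier_vec m" "rho_T B x = x + B *\<^sub>v k"
      using rho_T_eq_add_lattice[OF B indep x] by blast
    then have "rho_T B x = translation n (B *\<^sub>v k) x"
      using x by (simp add: translation_def)
    then show ?thesis
      using orbit_eq_iff[OF SA x rho_closed[OF x]] translation_mult_in_generate[OF SA B cols k(1)]
      by metis
  qed
  \<comment> \<open>Points in the image are fixed by \<open>rho_T B\<close>; this lets a
    representative \<open>y\<close> be rewritten below as \<open>rho_T B y\<close>.\<close>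
  have rho_idem: "rho_T B (rho_T B x) = rho_T B x" if "x \<in> carrier_vec n" for x
    using rho_T_eq_add_lattice[OF B indep that] rho_T_add_lattice[OF B indep that] by metis
  \<comment> \<open>Among representatives the rotations alone detect orbits, since
    \<open>rho_T B\<close> absorbs the translation part of a group element.\<close>
  have cls: "y \<in> {rot_star B r w | r. r \<in> rotations_in n S} \<longleftrightarrow> ?orb y = ?orb w"
    if "w \<in> rho_T B ` Z" "y \<in> rho_T B ` Z" for w y
  proof
    have w: "w \<in> carrier_vec n" and y: "y \<in> carrier_vec n" and y_fix: "rho_T B y = y"
      using that assms(4) rho_closed rho_idem by auto
    {
      assume "y \<in> {rot_star B r w | r. r \<in> rotations_in n S}"
      then obtain r where r: "r \<in> ?G" "y = rho_T B (r w)"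
        by (auto simp: rot_star_def rotations_in_def)
      have rw: "r w \<in> carrier_vec n"
        by (rule generate_closed[OF SA r(1) w])
      have "?orb (r w) = ?orb w"
        using orbit_eq_iff[OF SA w rw] r(1) by metis
      then show "?orb y = ?orb w"
        using orb_rho[OF rw] r(2) by simp
    next
      assume "?orb y = ?orb w"
      then obtain g where g: "g \<in> ?G" "y = g w"
        using orbit_eq_iff[OF SA w y] by metis
      obtain v R where v: "v \<in> carrier_vec n" "translation n v \<in> ?G"
        and R: "orthogonal_int_mat n R" "rotation n R \<in> ?G"
        and gx: "\<And>x. x \<in> carrier_vec n \<Longrightarrow> g x = R *\<^sub>v x + v"
        using generate_factorization[OF SA g(1)] by metis
      have Rw: "R *\<^sub>v w \<in> carrier_vec n"
        using orthogonal_int_matD(1)[OF R(1)] w by auto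
      \<comment> \<open>Here it matters that the translation part of \<open>g\<close> lies in the
        group: only then is it an integer combination of the columns of \<open>B\<close>.\<close>
      have "translation n v \<in> translations_in n S"
        using v by (auto simp: translations_in_def is_translation_def)
      then obtain k where k: "k \<in> carrier_vec m" "translation n v = translation n (B *\<^sub>v k)"
        using span by blast
      have "y = translation n v (R *\<^sub>v w)"
        using g(2) gx[OF w] Rw by (simp add: translation_def)
      also have "\<dots> = R *\<^sub>v w + B *\<^sub>v k"
        using k(2) Rw by (simp add: translation_def)
      finally have "y = rho_T B (R *\<^sub>v w)"
        using rho_T_add_lattice[OF B indep Rw k(1)] y_fix by simp
      then have "y = rot_star B (rotation n R) w"
        using w by (simp add: rot_star_def rotation_def)
      moreover have "rotation n R \<in> rotations_in n S"
        using R by (auto simp: rotations_in_def is_rotation_def)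
      ultimately show "y \<in> {rot_star B r w | r. r \<in> rotations_in n S}"
        by blast
    }
  qed
  have "rho_WL n S B pick Z (rho_T B x) = rho_WL n S B pick Z (rho_T B x') \<longleftrightarrow> ?orb x = ?orb x'"
    if "x \<in> Z" "x' \<in> Z" for x x'
  proof -
    \<comment> \<open>The loop lemma applies with the orbit map as \<open>f\<close>; passing from
      \<open>x\<close> to its representative then leaves the orbit unchanged.\<close>
    have "rho_WL n S B pick Z (rho_T B x) = rho_WL n S B pick Z (rho_T B x') \<longleftrightarrow>
      ?orb (rho_T B x) = ?orb (rho_T B x')"
      unfolding rho_WL_def
      by (rule while_class_labels[OF _ assms(7) cls]) (use that assms(5) in auto)
    then show ?thesis
      using that assms(4) orb_rho[of x] orb_rho[of x'] by (simp add: subset_iff)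
  qed
  then show ?thesis
    by (auto simp: orbit_labeling_on_def)
qed

end
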